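(* Let $(X,\|\cdot\|)$ be a (real) quasi-Banach space and let $T:X\to X$ be a $(b,\theta)$-enriched contraction, i.e. there are constants $b\in[0,+\infty)$ and $\theta\in[0,b+1)$ such that $$\|b(x-y)+Tx-Ty\|\le \theta\,\|x-y\|\quad\text{for all }x,y\in X.$$ Then: (i) $T$ has exactly one fixed point: $\mathrm{Fix}(T)=\{p\}$ for some $p\in X$; (ii) there exists $\lambda\in(0,1]$ such that, for any $x_0\in X$, the sequence $\{x_n\}_{n=0}^\infty$ given by $$x_{n+1}=(1-\lambda)x_n+\lambda T x_n,\quad n\ge 0,$$ converges to $p$.
   Context: All vector spaces are real. A quasi-norm on a real vector space $X$ is a map $\|\cdot\|:X\to[0,\infty)$ such that: $\|x\|=0$ if and only if $x=0$; $\|\lambda x\|=|\lambda|\,\|x\|$ for all $x\in X$, $\lambda\in\mathbb{R}$; and there is a constant $C\ge 1$, independent of $x,y$, with $\|x+y\|\le C(\|x\|+\|y\|)$ for all $x,y\in X$. A quasi-normed space is a real vector space equipped with a quasi-norm. A sequence $\{x_n\}$ converges to $x$ if $\|x_n-x\|\to 0$, and is Cauchy if $\|x_n-x_m\|\to 0$ as $n,m\to\infty$. A quasi-Banach space is a complete quasi-normed space, i.e. one in which every Cauchy sequence converges to an element of $X$. $\mathrm{Fix}(T)=\{x\in X: Tx=x\}$ denotes the set of fixed points of $T$. *)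

theory Defs
  imports Complex_Main
begin

text \<open>The vector space \<open>X\<close> is a whole type of class \<^class>\<open>real_vector\<close>; the quasi-norm is an
  explicit function \<open>q\<close> on it, since \<^class>\<open>real_normed_vector\<close> would force the triangle
  inequality with constant 1.\<close>

definition quasi_norm :: "('a::real_vector \<Rightarrow> real) \<Rightarrow> bool" where
  "quasi_norm q \<longleftrightarrow>
     (\<forall>x. 0 \<le> q x) \<and>
     (\<forall>x. q x = 0 \<longleftrightarrow> x = 0) \<and>
     (\<forall>r x. q (r *\<^sub>R x) = \<bar>r\<bar> * q x) \<and>
     (\<exists>C\<ge>1. \<forall>x y. q (x + y) \<le> C * (q x + q y))"

definition q_converges :: "('a::real_vector \<Rightarrow> real) \<Rightarrow> (nat \<Rightarrow> 'a) \<Rightarrow> 'a \<Rightarrow> bool" where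
  "q_converges q u x \<longleftrightarrow> (\<lambda>n. q (u n - x)) \<longlonglongrightarrow> 0"

definition q_Cauchy :: "('a::real_vector \<Rightarrow> real) \<Rightarrow> (nat \<Rightarrow> 'a) \<Rightarrow> bool" where
  "q_Cauchy q u \<longleftrightarrow> (\<forall>\<epsilon>>0. \<exists>N. \<forall>n\<ge>N. \<forall>m\<ge>N. q (u n - u m) < \<epsilon>)"

definition quasi_Banach :: "('a::real_vector \<Rightarrow> real) \<Rightarrow> bool" where
  "quasi_Banach q \<longleftrightarrow> quasi_norm q \<and> (\<forall>u. q_Cauchy q u \<longrightarrow> (\<exists>x. q_converges q u x))"

definition enriched_contraction ::
    "('a::real_vector \<Rightarrow> real) \<Rightarrow> real \<Rightarrow> real \<Rightarrow> ('a \<Rightarrow> 'a) \<Rightarrow> bool" where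
  "enriched_contraction q b \<theta> T \<longleftrightarrow>
     0 \<le> b \<and> 0 \<le> \<theta> \<and> \<theta> < b + 1 \<and>
     (\<forall>x y. q (b *\<^sub>R (x - y) + T x - T y) \<le> \<theta> * q (x - y))"

definition Fix :: "('a \<Rightarrow> 'a) \<Rightarrow> 'a set" where
  "Fix T = {x. T x = x}"

primrec krasnoselskij :: "real \<Rightarrow> ('a::real_vector \<Rightarrow> 'a) \<Rightarrow> 'a \<Rightarrow> nat \<Rightarrow> 'a" where
  "krasnoselskij l T x0 0 = x0"
| "krasnoselskij l T x0 (Suc n) =
     (1 - l) *\<^sub>R krasnoselskij l T x0 n + l *\<^sub>R T (krasnoselskij l T x0 n)"

end

theory Submission
  imports Defs
begin

text \<open>The averaged map \<open>S x = (1 - \<lambda>) x + \<lambda> T x\<close> has the same fixed points as \<open>T\<close> for every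
  \<open>\<lambda> \<noteq> 0\<close>. For \<open>\<lambda> = 1 / (b + 1)\<close> the difference \<open>S x - S y\<close> is exactly \<open>\<lambda>\<close> times
  \<open>b (x - y) + T x - T y\<close>, so \<open>S\<close> is an ordinary contraction with factor \<open>c = \<theta> / (b + 1) < 1\<close>,
  and the Krasnoselskij iterates of \<open>T\<close> are the Picard iterates of \<open>S\<close>. What remains is the
  Banach fixed point theorem in a quasi-Banach space.

  The usual telescoping estimate of \<open>S\<^sup>m x - S\<^sup>n x\<close> fails there, because each use of the
  quasi-triangle inequality costs a factor \<open>C\<close>, and \<open>C c\<close> may exceed 1. Instead, fix \<open>k\<close> with
  \<open>C c\<^sup>k \<le> 1/2\<close>: one application of the inequality to the contraction \<open>S\<^sup>k\<close> already shows that
  orbits are bounded (lemma \<open>contraction_orbit_bounded\<close>). A bounded orbit is Cauchy, since applying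
  \<open>S\<^sup>n\<close> shrinks all its distances by \<open>c\<^sup>n\<close>. Its limit is a fixed point, and comparison with
  this point shows that every other orbit has the same limit.\<close>

lemma quasi_norm_minus_commute:
  assumes "quasi_norm q"
  shows "q (x - y) = q (y - x)"
proof -
  have "q ((-1) *\<^sub>R (y - x)) = \<bar>-1\<bar> * q (y - x)"
    using assms unfolding quasi_norm_def by blast
  then show ?thesis by simp
qed

lemma contraction_funpow:
  fixes q :: "'a::real_vector \<Rightarrow> real"
  assumes "0 \<le> c" and contr: "\<And>x y. q (S x - S y) \<le> c * q (x - y)"
  shows "q ((S ^^ n) x - (S ^^ n) y) \<le> c ^ n * q (x - y)"
proof (induction n)
  case (Suc n)
  have "q ((S ^^ Suc n) x - (S ^^ Suc n) y) \<le> c * q ((S ^^ n) x - (S ^^ n) y)"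
    using contr by simp
  also have "\<dots> \<le> c * (c ^ n * q (x - y))"
    using Suc assms(1) by (rule mult_left_mono)
  finally show ?case by (simp add: mult.assoc)
qed simp

text \<open>Let \<open>A\<close> bound the distances of the first \<open>k\<close> iterates from the starting point \<open>x\<close>. If all
  iterates up to \<open>m\<close> lie within \<open>2 C A\<close> of \<open>x\<close>, then going from \<open>m\<close> to \<open>m + k\<close> halves that bound
  and adds at most \<open>C A\<close>, so the bound reproduces itself.\<close>

lemma contraction_orbit_bounded:
  fixes q :: "'a::real_vector \<Rightarrow> real"
  assumes qn: "quasi_norm q" and c: "0 \<le> c" "c < 1"
    and contr: "\<And>x y. q (S x - S y) \<le> c * q (x - y)"
  obtains M where "0 \<le> M" "\<And>m. q ((S ^^ m) x - x) \<le> M"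
proof -
  have nonneg: "0 \<le> q y" for y
    using qn by (simp add: quasi_norm_def)
  obtain C where C: "1 \<le> C" and tri: "\<And>y z. q (y + z) \<le> C * (q y + q z)"
    using qn unfolding quasi_norm_def by blast
  have "(\<lambda>k. C * c ^ k) \<longlonglongrightarrow> C * 0"
    using c by (intro tendsto_mult tendsto_const LIMSEQ_realpow_zero)
  then have "\<forall>\<^sub>F k in sequentially. C * c ^ k < 1/2"
    by (rule order_tendstoD) simp
  then obtain k0 where k0: "\<And>k. k \<ge> k0 \<Longrightarrow> C * c ^ k < 1/2"
    unfolding eventually_sequentially by blast
  \<comment> \<open>The step width must be positive for the strong induction below to descend.\<close>
  define k where "k = Suc k0"
  have k: "0 < k" "C * c ^ k \<le> 1/2"
    using k0[of k] by (auto simp: k_def)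
  define A where "A = Max ((\<lambda>j. q ((S ^^ j) x - x)) ` {..k})"
  have A: "q ((S ^^ j) x - x) \<le> A" if "j \<le> k" for j
    unfolding A_def using that by (intro Max_ge) auto
  have "0 \<le> A"
    using A[of k] nonneg[of "(S ^^ k) x - x"] by linarith
  have "A \<le> C * A"
    using mult_right_mono[OF C \<open>0 \<le> A\<close>] by simp
  have bound: "q ((S ^^ m) x - x) \<le> 2 * (C * A)" for m
  proof (induction m rule: less_induct)
    case (less m)
    show ?case
    proof (cases "m \<le> k")
      case True
      then show ?thesis
        using A[of m] \<open>A \<le> C * A\<close> \<open>0 \<le> A\<close> by linarith
    next
      case False
      define j where "j = m - k"
      have j: "m = k + j" "j < m"
        using False k(1) by (simp_all add: j_def)
      have "q ((S ^^ m) x - x)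
          = q (((S ^^ k) ((S ^^ j) x) - (S ^^ k) x) + ((S ^^ k) x - x))"
        by (simp add: j funpow_add)
      also have "\<dots> \<le> C * (q ((S ^^ k) ((S ^^ j) x) - (S ^^ k) x) + q ((S ^^ k) x - x))"
        by (rule tri)
      also have "\<dots> \<le> C * (c ^ k * q ((S ^^ j) x - x) + A)"
        using C contraction_funpow[of c q S, OF c(1) contr] A[of k]
        by (intro mult_left_mono add_mono) auto
      also have "\<dots> = (C * c ^ k) * q ((S ^^ j) x - x) + C * A"
        by (simp add: algebra_simps)
      also have "\<dots> \<le> 1/2 * (2 * (C * A)) + C * A"
        using k(2) less.IH[OF j(2)] nonneg by (intro add_right_mono mult_mono) auto
      finally show ?thesis by linarith
    qed
  qed
  then show ?thesis
    using that[of "2 * (C * A)"] \<open>A \<le> C * A\<close> \<open>0 \<le> A\<close> by auto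
qed

lemma contraction_orbit_Cauchy:
  fixes q :: "'a::real_vector \<Rightarrow> real"
  assumes qn: "quasi_norm q" and c: "0 \<le> c" "c < 1"
    and contr: "\<And>x y. q (S x - S y) \<le> c * q (x - y)"
  shows "q_Cauchy q (\<lambda>n. (S ^^ n) x)"
  unfolding q_Cauchy_def
proof (intro allI impI)
  fix e :: real
  assume "e > 0"
  obtain M where M: "0 \<le> M" "\<And>m. q ((S ^^ m) x - x) \<le> M"
    using contraction_orbit_bounded[of q c S x, OF qn c contr] by blast
  have "(\<lambda>n. c ^ n * M) \<longlonglongrightarrow> 0 * M"
    using c by (intro tendsto_mult tendsto_const LIMSEQ_realpow_zero)
  then have "\<forall>\<^sub>F n in sequentially. c ^ n * M < e"
    by (rule order_tendstoD) (simp add: \<open>e > 0\<close>)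
  then obtain N where N: "\<And>n. n \<ge> N \<Longrightarrow> c ^ n * M < e"
    unfolding eventually_sequentially by blast
  have later: "q ((S ^^ (n + d)) x - (S ^^ n) x) < e" if "N \<le> n" for n d
  proof -
    have "q ((S ^^ (n + d)) x - (S ^^ n) x) \<le> c ^ n * q ((S ^^ d) x - x)"
      using contraction_funpow[of c q S, OF c(1) contr] by (simp add: funpow_add)
    also have "\<dots> \<le> c ^ n * M"
      using M(2) c(1) by (intro mult_left_mono) auto
    finally show ?thesis using N[OF that] by linarith
  qed
  have "q ((S ^^ n) x - (S ^^ m) x) < e" if "N \<le> n" "N \<le> m" for n m
  proof (cases "m \<le> n")
    case True
    then show ?thesis using later[OF that(2), of "n - m"] by simp
  next
    case False
    then show ?thesis
      using later[OF that(1), of "m - n"] quasi_norm_minus_commute[OF qn] by simp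
  qed
  then show "\<exists>N. \<forall>n\<ge>N. \<forall>m\<ge>N. q ((S ^^ n) x - (S ^^ m) x) < e" by blast
qed

text \<open>A quasi-norm need not be continuous, so the limit \<open>p\<close> of an orbit cannot be shown to be fixed
  by passing to the limit inside \<open>q\<close>. The quasi-triangle inequality through \<open>S\<^sup>n\<^sup>+\<^sup>1 x\<close> bounds
  \<open>q (S p - p)\<close> by a null sequence instead.\<close>

theorem quasi_Banach_contraction:
  fixes q :: "'a::real_vector \<Rightarrow> real"
  assumes qB: "quasi_Banach q" and c: "0 \<le> c" "c < 1"
    and contr: "\<And>x y. q (S x - S y) \<le> c * q (x - y)"
  obtains p where "Fix S = {p}" "\<And>x. q_converges q (\<lambda>n. (S ^^ n) x) p"
proof -
  have qn: "quasi_norm q"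
    using qB by (simp add: quasi_Banach_def)
  have nonneg: "0 \<le> q y" and zero: "q y = 0 \<longleftrightarrow> y = 0" for y
    using qn by (simp_all add: quasi_norm_def)
  obtain C where C: "1 \<le> C" and tri: "\<And>y z. q (y + z) \<le> C * (q y + q z)"
    using qn unfolding quasi_norm_def by blast
  define u where "u n = (S ^^ n) 0" for n
  have "q_Cauchy q u"
    unfolding u_def by (rule contraction_orbit_Cauchy[of q c S, OF qn c contr])
  then obtain p where "q_converges q u p"
    using qB by (auto simp: quasi_Banach_def)
  then have lim: "(\<lambda>n. q (u n - p)) \<longlonglongrightarrow> 0"
    by (simp add: q_converges_def)
  have est: "q (S p - p) \<le> C * (c * q (u n - p) + q (u (Suc n) - p))" for n
  proof -
    have "q (S p - p) \<le> C * (q (S p - u (Suc n)) + q (u (Suc n) - p))"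
      using tri[of "S p - u (Suc n)" "u (Suc n) - p"] by simp
    also have "\<dots> \<le> C * (c * q (u n - p) + q (u (Suc n) - p))"
      using C contr[of p "u n"] quasi_norm_minus_commute[OF qn, of p "u n"]
      by (intro mult_left_mono add_right_mono) (auto simp: u_def)
    finally show ?thesis .
  qed
  have "(\<lambda>n. C * (c * q (u n - p) + q (u (Suc n) - p))) \<longlonglongrightarrow> C * (c * 0 + 0)"
    by (intro tendsto_mult tendsto_add tendsto_const lim LIMSEQ_Suc[OF lim])
  then have "q (S p - p) \<le> C * (c * 0 + 0)"
    by (rule LIMSEQ_le_const) (simp add: est)
  then have fixed: "S p = p"
    using nonneg[of "S p - p"] zero[of "S p - p"] by simp
  have unique: "y = p" if "S y = y" for y
  proof -
    have "(1 - c) * q (y - p) \<le> 0"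
      using contr[of y p] that fixed by (simp add: algebra_simps)
    then have "q (y - p) \<le> 0"
      using c(2) by (simp add: mult_le_0_iff)
    then show ?thesis
      using nonneg[of "y - p"] zero[of "y - p"] by simp
  qed
  have "q_converges q (\<lambda>n. (S ^^ n) x) p" for x
    unfolding q_converges_def
  proof (rule tendsto_sandwich[where h = "\<lambda>n. c ^ n * q (x - p)", OF _ _ tendsto_const])
    have fixed_pow: "(S ^^ n) p = p" for n
      by (induction n) (simp_all add: fixed)
    show "\<forall>\<^sub>F n in sequentially. q ((S ^^ n) x - p) \<le> c ^ n * q (x - p)"
      using contraction_funpow[of c q S _ x p, OF c(1) contr] by (simp add: fixed_pow)
    have "(\<lambda>n. c ^ n * q (x - p)) \<longlonglongrightarrow> 0 * q (x - p)"
      using c by (intro tendsto_mult tendsto_const LIMSEQ_realpow_zero)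
    then show "(\<lambda>n. c ^ n * q (x - p)) \<longlonglongrightarrow> 0" by simp
    show "\<forall>\<^sub>F n in sequentially. 0 \<le> q ((S ^^ n) x - p)"
      by (simp add: nonneg)
  qed
  moreover have "Fix S = {p}"
    unfolding Fix_def using fixed by (blast dest: unique)
  ultimately show ?thesis by (intro that)
qed

definition averaged :: "real \<Rightarrow> ('a::real_vector \<Rightarrow> 'a) \<Rightarrow> 'a \<Rightarrow> 'a" where
  "averaged l T x = (1 - l) *\<^sub>R x + l *\<^sub>R T x"

lemma krasnoselskij_eq_funpow: "krasnoselskij l T x n = (averaged l T ^^ n) x"
  by (induction n) (simp_all add: averaged_def)

lemma Fix_averaged:
  assumes "l \<noteq> 0"
  shows "Fix (averaged l T) = Fix T"
proof -
  have "averaged l T x - x = l *\<^sub>R (T x - x)" for x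
    by (simp add: averaged_def algebra_simps)
  then have "averaged l T x = x \<longleftrightarrow> T x = x" for x
    using assms by (metis eq_iff_diff_eq_0 scaleR_eq_0_iff)
  then show ?thesis by (simp add: Fix_def)
qed

text \<open>The weight \<open>1 / (b + 1)\<close> is the one for which \<open>1 - \<lambda> = \<lambda> b\<close>, so that the difference of the
  averages is a multiple of the vector controlled by the enriched contraction condition.\<close>

lemma enriched_contraction_averaged:
  assumes qn: "quasi_norm q" and ec: "enriched_contraction q b \<theta> T"
  shows "q (averaged (1 / (b + 1)) T x - averaged (1 / (b + 1)) T y) \<le> \<theta> / (b + 1) * q (x - y)"
proof -
  have b: "0 \<le> b" and ineq: "q (b *\<^sub>R (x - y) + T x - T y) \<le> \<theta> * q (x - y)"
    using ec by (simp_all add: enriched_contraction_def)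
  define l where "l = 1 / (b + 1)"
  have l: "0 < l" "1 - l = l * b"
    using b by (simp_all add: l_def field_simps)
  have "averaged l T x - averaged l T y = l *\<^sub>R (b *\<^sub>R (x - y) + T x - T y)"
    unfolding averaged_def l(2) by (simp add: algebra_simps)
  then have "q (averaged l T x - averaged l T y) = \<bar>l\<bar> * q (b *\<^sub>R (x - y) + T x - T y)"
    using qn by (simp add: quasi_norm_def)
  also have "\<dots> \<le> l * (\<theta> * q (x - y))"
    using mult_left_mono[OF ineq, of l] l(1) by simp
  finally show ?thesis by (simp add: l_def)
qed

theorem theorem2:
  fixes q :: "'a::real_vector \<Rightarrow> real" and T :: "'a \<Rightarrow> 'a" and b \<theta> :: real
  assumes "quasi_Banach q"
    and "enriched_contraction q b \<theta> T"
  shows "\<exists>p. Fix T = {p} \<and>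
           (\<exists>l. 0 < l \<and> l \<le> 1 \<and> (\<forall>x0. q_converges q (krasnoselskij l T x0) p))"
proof -
  define l where "l = 1 / (b + 1)"
  have b: "0 \<le> b" and \<theta>: "0 \<le> \<theta>" "\<theta> < b + 1"
    using assms(2) by (simp_all add: enriched_contraction_def)
  have l: "0 < l" "l \<le> 1"
    using b by (simp_all add: l_def)
  have c: "0 \<le> \<theta> / (b + 1)" "\<theta> / (b + 1) < 1"
    using b \<theta> by simp_all
  have "quasi_norm q"
    using assms(1) by (simp add: quasi_Banach_def)
  then have contr: "q (averaged l T x - averaged l T y) \<le> \<theta> / (b + 1) * q (x - y)" for x y
    unfolding l_def using assms(2) by (rule enriched_contraction_averaged)
  obtain p where p: "Fix (averaged l T) = {p}"
      "\<And>x. q_converges q (\<lambda>n. (averaged l T ^^ n) x) p"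
    using quasi_Banach_contraction[of q _ "averaged l T", OF assms(1) c contr] by metis
  have "krasnoselskij l T x = (\<lambda>n. (averaged l T ^^ n) x)" for x
    by (rule ext) (rule krasnoselskij_eq_funpow)
  then show ?thesis
    using l p Fix_averaged[of l T] by auto
qed

end
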